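(* Let $a,b$ be nonzero real numbers and let \[ Q_{l}=\begin{pmatrix} a^{2}+\frac{2a}{b} & \frac{a^{2}}{b} \\ a & \frac{2a}{b}\end{pmatrix}. \] Then for every positive integer $n$, \[ Q_{l}^{n}=\begin{cases} \left(\frac{a}{b}\right)^{n}(ab+4)^{\frac{n}{2}}\begin{pmatrix} q_{n+1} & q_{n} \\ \frac{b}{a}q_{n} & q_{n-1}\end{pmatrix}, & n \text{ even},\\[2mm] \left(\frac{a}{b}\right)^{n}(ab+4)^{\frac{n-1}{2}}\begin{pmatrix} l_{n+1} & l_{n} \\ \frac{b}{a}l_{n} & l_{n-1}\end{pmatrix}, & n \text{ odd}, \end{cases} \] where $q_n$ and $l_n$ are the $n$th bi-periodic Fibonacci and bi-periodic Lucas numbers with parameters $a,b$.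
   Context: The bi-periodic Fibonacci sequence $(q_n)_{n\ge 0}$ is defined by $q_0=0$, $q_1=1$, and $q_n=aq_{n-1}+q_{n-2}$ if $n$ is even, $q_n=bq_{n-1}+q_{n-2}$ if $n$ is odd ($n\ge 2$). The bi-periodic Lucas sequence $(l_n)_{n\ge 0}$ is defined by $l_0=2$, $l_1=a$, and $l_n=bl_{n-1}+l_{n-2}$ if $n$ is even, $l_n=al_{n-1}+l_{n-2}$ if $n$ is odd ($n\ge 2$). Here $a,b$ are nonzero real numbers. *)

theory Defs
  imports Complex_Main "Jordan_Normal_Form.Matrix"
begin

fun biperiodic_fib :: "real \<Rightarrow> real \<Rightarrow> nat \<Rightarrow> real" where
  "biperiodic_fib a b 0 = 0"
| "biperiodic_fib a b (Suc 0) = 1"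
| "biperiodic_fib a b (Suc (Suc n)) =
     (if even (Suc (Suc n)) then a else b) * biperiodic_fib a b (Suc n) + biperiodic_fib a b n"

fun biperiodic_lucas :: "real \<Rightarrow> real \<Rightarrow> nat \<Rightarrow> real" where
  "biperiodic_lucas a b 0 = 2"
| "biperiodic_lucas a b (Suc 0) = a"
| "biperiodic_lucas a b (Suc (Suc n)) =
     (if even (Suc (Suc n)) then b else a) * biperiodic_lucas a b (Suc n) + biperiodic_lucas a b n"

definition mat22 :: "real \<Rightarrow> real \<Rightarrow> real \<Rightarrow> real \<Rightarrow> real mat" where
  "mat22 x y z w = mat_of_rows_list 2 [[x, y], [z, w]]"

definition Q_l :: "real \<Rightarrow> real \<Rightarrow> real mat" where
  "Q_l a b = mat22 (a\<^sup>2 + 2 * a / b) (a\<^sup>2 / b)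
                   a                 (2 * a / b)"

end

theory Submission
  imports Defs
begin

text \<open>
  Write \<open>Q_l = (a / b) M\<close>, with \<open>M\<close> the matrix with rows \<open>(ab + 2, a)\<close> and \<open>(b, 2)\<close>. Right
  multiplication by \<open>M\<close> turns the Fibonacci matrix of an even index \<open>n\<close> into the Lucas matrix of
  index \<open>n + 1\<close>, because \<open>l\<^sub>k\<^sub>+\<^sub>1 = q\<^sub>k + q\<^sub>k\<^sub>+\<^sub>2\<close>; it turns the Lucas matrix of an odd
  index \<open>n\<close> into \<open>ab + 4\<close> times the Fibonacci matrix of index \<open>n + 1\<close>, because
  \<open>l\<^sub>k + l\<^sub>k\<^sub>+\<^sub>2 = (ab + 4) q\<^sub>k\<^sub>+\<^sub>1\<close>.
\<close>

text \<open>Both sides obey the same recurrence in \<open>n\<close>: the Lucas coefficients are the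
  Fibonacci ones with parities swapped, and the indices on the two sides differ by one.\<close>

lemma biperiodic_lucas_Suc:
  "biperiodic_lucas a b (Suc n) = biperiodic_fib a b n + biperiodic_fib a b (Suc (Suc n))"
proof (induction n rule: induct_nat_012)
  case (ge2 n)
  have "biperiodic_lucas a b (Suc (Suc (Suc n))) =
      (if even n then a else b) * biperiodic_lucas a b (Suc (Suc n)) + biperiodic_lucas a b (Suc n)"
    by simp
  also have "\<dots> = ((if even n then a else b) * biperiodic_fib a b (Suc n) + biperiodic_fib a b n) +
      ((if even n then a else b) * biperiodic_fib a b (Suc (Suc (Suc n))) +
        biperiodic_fib a b (Suc (Suc n)))"
    unfolding ge2.IH by (simp only: distrib_left add_ac)
  also have "\<dots> = biperiodic_fib a b (Suc (Suc n)) + biperiodic_fib a b (Suc (Suc (Suc (Suc n))))"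
    by simp
  finally show ?case .
qed simp_all

text \<open>For n = k + 1 the left side is q(k) + 2 q(k+2) + q(k+4), and q(k+4) = (ab + 2) q(k+2) -
  q(k) for either parity of k. The case n = 0 is separate because
  \<open>biperiodic_lucas_Suc\<close> does not reach l(0).\<close>

lemma biperiodic_lucas_add_Suc_Suc:
  "biperiodic_lucas a b n + biperiodic_lucas a b (Suc (Suc n)) =
    (a * b + 4) * biperiodic_fib a b (Suc n)"
proof (cases n)
  case (Suc k)
  then show ?thesis
    unfolding Suc biperiodic_lucas_Suc by (simp add: algebra_simps)
qed simp

lemma mat22_times_mat22:
  "mat22 x y z w * mat22 x' y' z' w' =
    mat22 (x * x' + y * z') (x * y' + y * w') (z * x' + w * z') (z * y' + w * w')"
  unfolding mat22_def
  by (rule eq_matI)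
    (auto simp: mat_of_rows_list_def scalar_prod_def numeral_2_eq_2 less_Suc_eq)

lemma smult_mat22: "k \<cdot>\<^sub>m mat22 x y z w = mat22 (k * x) (k * y) (k * z) (k * w)"
  unfolding mat22_def
  by (rule eq_matI) (auto simp: mat_of_rows_list_def numeral_2_eq_2 less_Suc_eq)

lemma one_mat_eq_mat22: "1\<^sub>m 2 = mat22 1 0 0 1"
  unfolding mat22_def
  by (rule eq_matI) (auto simp: mat_of_rows_list_def numeral_2_eq_2 less_Suc_eq)

lemma dim_row_mat22 [simp]: "dim_row (mat22 x y z w) = 2"
  by (simp add: mat22_def mat_of_rows_list_def)

lemma smult_smult_mat: "k \<cdot>\<^sub>m (l \<cdot>\<^sub>m A) = (k * l) \<cdot>\<^sub>m (A :: 'a :: semigroup_mult mat)"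
  by (rule eq_matI) (simp_all add: mult.assoc)

lemma smult_mat22_times_smult_mat22:
  "(k \<cdot>\<^sub>m mat22 x y z w) * (k' \<cdot>\<^sub>m mat22 x' y' z' w') =
    (k * k') \<cdot>\<^sub>m (mat22 x y z w * mat22 x' y' z' w')"
  by (simp add: smult_mat22 mat22_times_mat22 algebra_simps)

lemma Q_l_eq_smult:
  assumes "b \<noteq> 0"
  shows "Q_l a b = (a / b) \<cdot>\<^sub>m mat22 (a * b + 2) a b 2"
  using assms by (simp add: Q_l_def smult_mat22 field_simps power2_eq_square)

text \<open>For odd \<open>m\<close> the recurrence has coefficient \<open>a\<close> at m + 3 and
  \<open>b\<close> at m + 2 and m + 4, which is what the entries of the right factor
  require.\<close>

lemma fib_mat22_times:
  assumes "a \<noteq> 0" and "odd m"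
  shows "mat22 (biperiodic_fib a b (Suc (Suc m))) (biperiodic_fib a b (Suc m))
            (b / a * biperiodic_fib a b (Suc m)) (biperiodic_fib a b m)
          * mat22 (a * b + 2) a b 2 =
        mat22 (biperiodic_lucas a b (Suc (Suc (Suc m)))) (biperiodic_lucas a b (Suc (Suc m)))
            (b / a * biperiodic_lucas a b (Suc (Suc m))) (biperiodic_lucas a b (Suc m))"
  using assms unfolding mat22_times_mat22 biperiodic_lucas_Suc
  by (simp add: field_simps)

lemma lucas_mat22_times:
  assumes "a \<noteq> 0" and "even m"
  shows "mat22 (biperiodic_lucas a b (Suc (Suc m))) (biperiodic_lucas a b (Suc m))
            (b / a * biperiodic_lucas a b (Suc m)) (biperiodic_lucas a b m)
          * mat22 (a * b + 2) a b 2 =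
        (a * b + 4) \<cdot>\<^sub>m
        mat22 (biperiodic_fib a b (Suc (Suc (Suc m)))) (biperiodic_fib a b (Suc (Suc m)))
            (b / a * biperiodic_fib a b (Suc (Suc m))) (biperiodic_fib a b (Suc m))"
proof -
  \<comment> \<open>This brings ab + 4 next to q in the lower left entry, so that the reversed
    identity can turn every entry into Lucas numbers.\<close>
  have "(a * b + 4) * (b / a * biperiodic_fib a b (Suc (Suc m))) =
      b / a * ((a * b + 4) * biperiodic_fib a b (Suc (Suc m)))"
    by simp
  then show ?thesis
    unfolding mat22_times_mat22 smult_mat22
    using assms by (simp only: biperiodic_lucas_add_Suc_Suc [symmetric]) (simp add: field_simps)
qed

theorem theorem2:
  fixes a b :: real and n :: nat
  assumes "a \<noteq> 0" and "b \<noteq> 0" and "n \<ge> 1"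
  shows "Q_l a b ^\<^sub>m n =
    (if even n then
       ((a / b) ^ n * (a * b + 4) ^ (n div 2)) \<cdot>\<^sub>m
         mat22 (biperiodic_fib a b (n + 1))     (biperiodic_fib a b n)
               (b / a * biperiodic_fib a b n)   (biperiodic_fib a b (n - 1))
     else
       ((a / b) ^ n * (a * b + 4) ^ ((n - 1) div 2)) \<cdot>\<^sub>m
         mat22 (biperiodic_lucas a b (n + 1))   (biperiodic_lucas a b n)
               (b / a * biperiodic_lucas a b n) (biperiodic_lucas a b (n - 1)))"
  using assms(3)
proof (induction n rule: nat_induct_at_least)
  case base
  have "Q_l a b ^\<^sub>m 1 = Q_l a b"
    by (simp add: Q_l_def one_mat_eq_mat22 mat22_times_mat22)
  then show ?case
    using assms(1,2) by (simp add: Q_l_eq_smult numeral_2_eq_2 mult.commute)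
next
  case (Suc n)
  \<comment> \<open>With \<open>n = Suc m\<close> the index n - 1 is just \<open>m\<close>, free of
    truncated subtraction.\<close>
  then obtain m where n: "n = Suc m"
    by (cases n) auto
  show ?case
  proof (cases "even m")
    \<comment> \<open>Here \<open>n\<close> is odd: the product contributes a factor ab + 4, raising
      its exponent from (n - 1) / 2 to (n + 1) / 2.\<close>
    case True
    then show ?thesis
      using Suc.IH assms(1,2) lucas_mat22_times [OF assms(1) True, of b]
      by (simp add: n Q_l_eq_smult smult_mat22_times_smult_mat22 smult_smult_mat mult_ac
          del: biperiodic_fib.simps biperiodic_lucas.simps)
  next
    \<comment> \<open>Here \<open>n\<close> is even: the exponent of ab + 4 stays n / 2, and only a
      / b gains a power.\<close>
    case False
    then show ?thesis
      using Suc.IH assms(1,2) fib_mat22_times [OF assms(1) False, of b]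
      by (simp add: n Q_l_eq_smult smult_mat22_times_smult_mat22 mult_ac
          del: biperiodic_fib.simps biperiodic_lucas.simps)
  qed
qed

end
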